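(* For every integer $n\ge 0$, let $Q([n])$ be the set of all model structures on the category $[n]$. Then $$\# Q([n]) = \binom{2n+1}{n}.$$
   Context: $[n]$ denotes the poset $\{0<1<\dots<n\}$ regarded as a category: there is a unique morphism $i\to j$ if $i\le j$ and none otherwise. A weak factorization system on a category $\mathcal C$ is a pair $(\mathcal L,\mathcal R)$ of classes of morphisms such that every morphism factors as $pi$ with $i\in\mathcal L$, $p\in\mathcal R$; every $i\in\mathcal L$ has the left lifting property with respect to every $p\in\mathcal R$; and $\mathcal L$, $\mathcal R$ are closed under retracts. A model structure on a category $\mathcal C$ with finite limits and colimits is a triple $(\mathsf W,\mathsf C,\mathsf F)$ of classes of morphisms (weak equivalences, cofibrations, fibrations) such that $\mathsf W$ satisfies the 2-out-of-3 property and, with $\mathsf{AF}=\mathsf W\cap\mathsf F$ and $\mathsf{AC}=\mathsf W\cap\mathsf C$, both $(\mathsf C,\mathsf{AF})$ and $(\mathsf{AC},\mathsf F)$ are weak factorization systems. Two model structures are counted as the same only if the three classes coincide. *)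

theory Defs
  imports Main
begin

record ('o, 'a) cat_data =
  Ob :: "'o set"
  Ar :: "'a set"
  Dom :: "'a \<Rightarrow> 'o"
  Cod :: "'a \<Rightarrow> 'o"
  Id :: "'o \<Rightarrow> 'a"
  Comp :: "'a \<Rightarrow> 'a \<Rightarrow> 'a"  \<comment> \<open>\<open>Comp C g f\<close> is \<open>g\<close> after \<open>f\<close>\<close>

definition hom :: "('o, 'a) cat_data \<Rightarrow> 'o \<Rightarrow> 'o \<Rightarrow> 'a set" where
  "hom C x y = {f \<in> Ar C. Dom C f = x \<and> Cod C f = y}"

locale category =
  fixes C :: "('o, 'a) cat_data"
  assumes Dom_in: "f \<in> Ar C \<Longrightarrow> Dom C f \<in> Ob C"
    and Cod_in: "f \<in> Ar C \<Longrightarrow> Cod C f \<in> Ob C"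
    and Id_in: "x \<in> Ob C \<Longrightarrow> Id C x \<in> hom C x x"
    and Comp_in: "f \<in> hom C x y \<Longrightarrow> g \<in> hom C y z \<Longrightarrow> Comp C g f \<in> hom C x z"
    and Id_left: "f \<in> hom C x y \<Longrightarrow> Comp C (Id C y) f = f"
    and Id_right: "f \<in> hom C x y \<Longrightarrow> Comp C f (Id C x) = f"
    and Comp_assoc: "f \<in> hom C w x \<Longrightarrow> g \<in> hom C x y \<Longrightarrow> h \<in> hom C y z \<Longrightarrow>
      Comp C h (Comp C g f) = Comp C (Comp C h g) f"

definition op_cat :: "('o, 'a) cat_data \<Rightarrow> ('o, 'a) cat_data" where
  "op_cat C = \<lparr>Ob = Ob C, Ar = Ar C, Dom = Cod C, Cod = Dom C, Id = Id C,
     Comp = (\<lambda>g f. Comp C f g)\<rparr>"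

definition is_functor ::
  "('i, 'u) cat_data \<Rightarrow> ('o, 'a) cat_data \<Rightarrow> ('i \<Rightarrow> 'o) \<Rightarrow> ('u \<Rightarrow> 'a) \<Rightarrow> bool" where
  "is_functor J C Fo Fa \<longleftrightarrow>
     (\<forall>j\<in>Ob J. Fo j \<in> Ob C) \<and>
     (\<forall>u\<in>Ar J. Fa u \<in> hom C (Fo (Dom J u)) (Fo (Cod J u))) \<and>
     (\<forall>j\<in>Ob J. Fa (Id J j) = Id C (Fo j)) \<and>
     (\<forall>u\<in>Ar J. \<forall>v\<in>Ar J. Cod J u = Dom J v \<longrightarrow> Fa (Comp J v u) = Comp C (Fa v) (Fa u))"

definition is_cone ::
  "('i, 'u) cat_data \<Rightarrow> ('o, 'a) cat_data \<Rightarrow> ('i \<Rightarrow> 'o) \<Rightarrow> ('u \<Rightarrow> 'a) \<Rightarrow> 'o \<Rightarrow> ('i \<Rightarrow> 'a) \<Rightarrow> bool"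
where
  "is_cone J C Fo Fa x p \<longleftrightarrow>
     x \<in> Ob C \<and>
     (\<forall>j\<in>Ob J. p j \<in> hom C x (Fo j)) \<and>
     (\<forall>u\<in>Ar J. Comp C (Fa u) (p (Dom J u)) = p (Cod J u))"

definition is_limit ::
  "('i, 'u) cat_data \<Rightarrow> ('o, 'a) cat_data \<Rightarrow> ('i \<Rightarrow> 'o) \<Rightarrow> ('u \<Rightarrow> 'a) \<Rightarrow> 'o \<Rightarrow> ('i \<Rightarrow> 'a) \<Rightarrow> bool"
where
  "is_limit J C Fo Fa x p \<longleftrightarrow>
     is_cone J C Fo Fa x p \<and>
     (\<forall>y q. is_cone J C Fo Fa y q \<longrightarrow>
       (\<exists>!h. h \<in> hom C y x \<and> (\<forall>j\<in>Ob J. Comp C (p j) h = q j)))"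

text \<open>Every finite category is isomorphic to one whose objects and morphisms are natural
  numbers, so it is enough to let the shapes range over these.\<close>

definition has_finite_limits :: "('o, 'a) cat_data \<Rightarrow> bool" where
  "has_finite_limits C \<longleftrightarrow>
     (\<forall>(J :: (nat, nat) cat_data) Fo Fa.
        category J \<and> finite (Ob J) \<and> finite (Ar J) \<and> is_functor J C Fo Fa \<longrightarrow>
        (\<exists>x p. is_limit J C Fo Fa x p))"

definition has_finite_colimits :: "('o, 'a) cat_data \<Rightarrow> bool" where
  "has_finite_colimits C \<longleftrightarrow> has_finite_limits (op_cat C)"

definition llp :: "('o, 'a) cat_data \<Rightarrow> 'a \<Rightarrow> 'a \<Rightarrow> bool" where
  "llp C i p \<longleftrightarrow>
     (\<forall>f\<in>hom C (Dom C i) (Dom C p). \<forall>g\<in>hom C (Cod C i) (Cod C p).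
        Comp C p f = Comp C g i \<longrightarrow>
        (\<exists>h\<in>hom C (Cod C i) (Dom C p). Comp C h i = f \<and> Comp C p h = g))"

definition is_retract :: "('o, 'a) cat_data \<Rightarrow> 'a \<Rightarrow> 'a \<Rightarrow> bool" where
  "is_retract C f g \<longleftrightarrow>
     (\<exists>s\<in>hom C (Dom C f) (Dom C g). \<exists>r\<in>hom C (Dom C g) (Dom C f).
      \<exists>t\<in>hom C (Cod C f) (Cod C g). \<exists>q\<in>hom C (Cod C g) (Cod C f).
        Comp C r s = Id C (Dom C f) \<and> Comp C q t = Id C (Cod C f) \<and>
        Comp C g s = Comp C t f \<and> Comp C f r = Comp C q g)"

definition retract_closed :: "('o, 'a) cat_data \<Rightarrow> 'a set \<Rightarrow> bool" where
  "retract_closed C S \<longleftrightarrow> (\<forall>g\<in>S. \<forall>f\<in>Ar C. is_retract C f g \<longrightarrow> f \<in> S)"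

definition weak_factorization_system :: "('o, 'a) cat_data \<Rightarrow> 'a set \<Rightarrow> 'a set \<Rightarrow> bool" where
  "weak_factorization_system C L R \<longleftrightarrow>
     L \<subseteq> Ar C \<and> R \<subseteq> Ar C \<and>
     (\<forall>f\<in>Ar C. \<exists>i\<in>L. \<exists>p\<in>R. Cod C i = Dom C p \<and> Comp C p i = f) \<and>
     (\<forall>i\<in>L. \<forall>p\<in>R. llp C i p) \<and>
     retract_closed C L \<and> retract_closed C R"

definition two_out_of_three :: "('o, 'a) cat_data \<Rightarrow> 'a set \<Rightarrow> bool" where
  "two_out_of_three C W \<longleftrightarrow>
     (\<forall>f\<in>Ar C. \<forall>g\<in>Ar C. Cod C f = Dom C g \<longrightarrow>
        (f \<in> W \<and> g \<in> W \<longrightarrow> Comp C g f \<in> W) \<and>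
        (f \<in> W \<and> Comp C g f \<in> W \<longrightarrow> g \<in> W) \<and>
        (g \<in> W \<and> Comp C g f \<in> W \<longrightarrow> f \<in> W))"

text \<open>The arguments are the weak equivalences, the cofibrations and the fibrations.\<close>

definition model_structure :: "('o, 'a) cat_data \<Rightarrow> 'a set \<Rightarrow> 'a set \<Rightarrow> 'a set \<Rightarrow> bool" where
  "model_structure C We Co Fi \<longleftrightarrow>
     category C \<and> has_finite_limits C \<and> has_finite_colimits C \<and>
     We \<subseteq> Ar C \<and> Co \<subseteq> Ar C \<and> Fi \<subseteq> Ar C \<and>
     two_out_of_three C We \<and>
     weak_factorization_system C Co (We \<inter> Fi) \<and>
     weak_factorization_system C (We \<inter> Co) Fi"

definition model_structures :: "('o, 'a) cat_data \<Rightarrow> ('a set \<times> 'a set \<times> 'a set) set" where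
  "model_structures C = {(We, Co, Fi). model_structure C We Co Fi}"

text \<open>The poset \<open>0 < 1 < \<dots> < n\<close> as a category; the unique morphism \<open>i \<rightarrow> j\<close> is the pair
  \<open>(i, j)\<close>.\<close>

definition ord_cat :: "nat \<Rightarrow> (nat, nat \<times> nat) cat_data" where
  "ord_cat n = \<lparr>Ob = {0..n}, Ar = {(i, j). i \<le> j \<and> j \<le> n}, Dom = fst, Cod = snd,
     Id = (\<lambda>i. (i, i)), Comp = (\<lambda>g f. (fst f, snd g))\<rparr>"

lemma category_ord_cat: "category (ord_cat n)"
  by unfold_locales (auto simp: ord_cat_def hom_def)

lemma has_finite_limits_ord_cat: "has_finite_limits (ord_cat n)"
  unfolding has_finite_limits_def
proof (intro allI impI, elim conjE)
  fix J :: "(nat, nat) cat_data" and Fo and Fa :: "nat \<Rightarrow> nat \<times> nat"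
  assume J: "category J" "finite (Ob J)" and F: "is_functor J (ord_cat n) Fo Fa"
  define x where "x = Min (insert n (Fo ` Ob J))"
  have fin: "finite (insert n (Fo ` Ob J))" using J by simp
  have x: "x \<le> n" "\<And>j. j \<in> Ob J \<Longrightarrow> x \<le> Fo j"
    unfolding x_def using fin by (auto intro: Min_le)
  have Fo: "\<And>j. j \<in> Ob J \<Longrightarrow> Fo j \<le> n"
    and Fa: "\<And>u. u \<in> Ar J \<Longrightarrow> Fa u = (Fo (Dom J u), Fo (Cod J u))"
    using F by (auto simp: is_functor_def ord_cat_def hom_def prod_eq_iff)
  have univ: "y \<le> x" if "y \<le> n" "\<And>j. j \<in> Ob J \<Longrightarrow> y \<le> Fo j" for y
    unfolding x_def using fin that by auto
  have "is_limit J (ord_cat n) Fo Fa x (\<lambda>j. (x, Fo j))"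
    unfolding is_limit_def
  proof (intro conjI allI impI)
    show "is_cone J (ord_cat n) Fo Fa x (\<lambda>j. (x, Fo j))"
      using x Fo Fa by (auto simp: is_cone_def ord_cat_def hom_def)
  next
    fix y q assume q: "is_cone J (ord_cat n) Fo Fa y q"
    have "y \<le> x"
      using q by (intro univ) (force simp: is_cone_def ord_cat_def hom_def)+
    then show "\<exists>!h. h \<in> hom (ord_cat n) y x \<and> (\<forall>j\<in>Ob J. Comp (ord_cat n) (x, Fo j) h = q j)"
      using q x
      by (intro ex1I[of _ "(y, x)"])
         (auto simp: is_cone_def ord_cat_def hom_def prod_eq_iff)
  qed
  then show "\<exists>x p. is_limit J (ord_cat n) Fo Fa x p" by blast
qed

lemma has_finite_colimits_ord_cat: "has_finite_colimits (ord_cat n)"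
  unfolding has_finite_colimits_def has_finite_limits_def
proof (intro allI impI, elim conjE)
  let ?C = "op_cat (ord_cat n)"
  fix J :: "(nat, nat) cat_data" and Fo and Fa :: "nat \<Rightarrow> nat \<times> nat"
  assume J: "category J" "finite (Ob J)" and F: "is_functor J ?C Fo Fa"
  define x where "x = Max (insert 0 (Fo ` Ob J))"
  have fin: "finite (insert 0 (Fo ` Ob J))" using J by simp
  have Fo: "\<And>j. j \<in> Ob J \<Longrightarrow> Fo j \<le> n"
    and Fa: "\<And>u. u \<in> Ar J \<Longrightarrow> Fa u = (Fo (Cod J u), Fo (Dom J u))"
    using F by (auto simp: is_functor_def ord_cat_def op_cat_def hom_def prod_eq_iff)
  have univ: "x \<le> y" if "\<And>j. j \<in> Ob J \<Longrightarrow> Fo j \<le> y" for y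
    unfolding x_def using fin that by auto
  have x: "x \<le> n" "\<And>j. j \<in> Ob J \<Longrightarrow> Fo j \<le> x"
    using univ[of n] Fo unfolding x_def using fin by (auto intro: Max_ge)
  have "is_limit J ?C Fo Fa x (\<lambda>j. (Fo j, x))"
    unfolding is_limit_def
  proof (intro conjI allI impI)
    show "is_cone J ?C Fo Fa x (\<lambda>j. (Fo j, x))"
      using x Fo Fa by (auto simp: is_cone_def ord_cat_def op_cat_def hom_def)
  next
    fix y q assume q: "is_cone J ?C Fo Fa y q"
    have "x \<le> y"
      using q by (intro univ) (force simp: is_cone_def ord_cat_def op_cat_def hom_def)
    moreover have "y \<le> n"
      using q by (simp add: is_cone_def ord_cat_def op_cat_def)
    ultimately show "\<exists>!h. h \<in> hom ?C y x \<and> (\<forall>j\<in>Ob J. Comp ?C (Fo j, x) h = q j)"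
      using q x
      by (intro ex1I[of _ "(x, y)"])
         (auto simp: is_cone_def ord_cat_def op_cat_def hom_def prod_eq_iff)
  qed
  then show "\<exists>x p. is_limit J ?C Fo Fa x p" by blast
qed

end

theory Submission
  imports Defs
begin

text \<open>
  In a model structure on a finite chain the weak equivalences are closed under passing to
  subintervals, so they amount to a partition of the chain into intervals, and together with the
  acyclic cofibrations they determine the other two classes by lifting. Let \<open>b j\<close> be the least
  element of the block of \<open>j\<close>, and \<open>l j\<close> the least \<open>i\<close> such that \<open>i \<rightarrow> j\<close> is an acyclic cofibration.
  Closure of acyclic cofibrations under pushout and composition turns model structures into the
  pairs \<open>(b, l)\<close> with \<open>b j \<le> l j \<le> j\<close>, \<open>b\<close> constant on \<open>[b j, j]\<close> and \<open>l j \<le> l i\<close> for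
  \<open>i \<in> [l j, j]\<close>.

  These pairs are counted by adjoining a new top element. If \<open>s\<close> is the number of
  \<open>a \<in> [b n, n]\<close> such that \<open>[a, n]\<close> is closed under \<open>l\<close>, the new element either opens a new block
  (and \<open>s\<close> becomes \<open>1\<close>), or joins the last block with \<open>s + 1\<close> choices for its value of \<open>l\<close>, after
  which \<open>s\<close> takes each of the values \<open>1, \<dots>, s + 1\<close> once. The number of ways to adjoin
  \<open>k\<close> elements is thus \<open>(2 k + s) choose k\<close>, by the hockey-stick identity.
\<close>

section \<open>Weak factorization systems on a chain\<close>

definition arrows :: "nat \<Rightarrow> (nat \<times> nat) set" where
  "arrows n = {(i, j). i \<le> j \<and> j \<le> n}"

text \<open>In a poset every square commutes, so the two premises say that a square from
  \<open>f\<close> to \<open>g\<close> exists and the conclusion that it has a diagonal.\<close>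

definition lifts :: "nat \<times> nat \<Rightarrow> nat \<times> nat \<Rightarrow> bool" where
  "lifts f g \<longleftrightarrow> (fst f \<le> fst g \<longrightarrow> snd f \<le> snd g \<longrightarrow> snd f \<le> fst g)"

definition chain_wfs :: "nat \<Rightarrow> (nat \<times> nat) set \<Rightarrow> (nat \<times> nat) set \<Rightarrow> bool" where
  "chain_wfs n L R \<longleftrightarrow> L \<subseteq> arrows n \<and> R \<subseteq> arrows n \<and>
     (\<forall>(i, j)\<in>arrows n. \<exists>k. (i, k) \<in> L \<and> (k, j) \<in> R) \<and> (\<forall>f\<in>L. \<forall>g\<in>R. lifts f g)"

lemma Ar_ord_cat: "Ar (ord_cat n) = arrows n"
  by (simp add: ord_cat_def arrows_def)

lemma llp_ord_cat:
  assumes "f \<in> arrows n" "g \<in> arrows n"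
  shows "llp (ord_cat n) f g \<longleftrightarrow> lifts f g"
  using assms
  by (cases f; cases g) (auto simp: llp_def lifts_def arrows_def ord_cat_def hom_def)

text \<open>A retract diagram has arrows both ways between the domains and between the codomains;
  antisymmetry makes the retract equal to the original arrow.\<close>

lemma retract_closed_ord_cat: "retract_closed (ord_cat n) S"
  by (auto simp: retract_closed_def is_retract_def ord_cat_def hom_def)

lemma weak_factorization_system_ord_cat:
  "weak_factorization_system (ord_cat n) L R \<longleftrightarrow> chain_wfs n L R"
proof -
  have fact: "(\<exists>i\<in>L. \<exists>p\<in>R. Cod (ord_cat n) i = Dom (ord_cat n) p \<and> Comp (ord_cat n) p i = f)
      \<longleftrightarrow> (case f of (i, j) \<Rightarrow> \<exists>k. (i, k) \<in> L \<and> (k, j) \<in> R)" for f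
    by (cases f) (force simp: ord_cat_def)
  have "(\<forall>i\<in>L. \<forall>p\<in>R. llp (ord_cat n) i p) \<longleftrightarrow> (\<forall>i\<in>L. \<forall>p\<in>R. lifts i p)"
    if "L \<subseteq> arrows n" "R \<subseteq> arrows n"
    using that llp_ord_cat by blast
  then show ?thesis
    unfolding weak_factorization_system_def chain_wfs_def fact Ar_ord_cat
    by (simp add: retract_closed_ord_cat cong: conj_cong)
qed

lemma chain_wfsD:
  assumes "chain_wfs n L R"
  shows chain_wfs_factor: "\<And>i j. i \<le> j \<Longrightarrow> j \<le> n \<Longrightarrow> \<exists>k. i \<le> k \<and> k \<le> j \<and> (i, k) \<in> L \<and> (k, j) \<in> R"
    and chain_wfs_lift: "\<And>i j k l. (i, j) \<in> L \<Longrightarrow> (k, l) \<in> R \<Longrightarrow> i \<le> k \<Longrightarrow> j \<le> l \<Longrightarrow> j \<le> k"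
  using assms unfolding chain_wfs_def arrows_def lifts_def by fastforce+

text \<open>The retract argument: factor \<open>(i, j)\<close> through \<open>k\<close>; lifting it
  against its right factor \<open>(k, j)\<close> gives j <= k, so it equals its left factor.\<close>

lemma chain_wfs_left_eq:
  assumes "chain_wfs n L R"
  shows "L = {f \<in> arrows n. \<forall>g\<in>R. lifts f g}"
proof (intro equalityI subsetI)
  fix f assume f: "f \<in> {f \<in> arrows n. \<forall>g\<in>R. lifts f g}"
  obtain i j where [simp]: "f = (i, j)" by (cases f)
  obtain k where "i \<le> k" "k \<le> j" "(i, k) \<in> L" "(k, j) \<in> R"
    using f chain_wfs_factor[OF assms, of i j] by (auto simp: arrows_def)
  then show "f \<in> L" using f by (force simp: lifts_def)
qed (use assms in \<open>auto simp: chain_wfs_def\<close>)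

lemma chain_wfs_right_eq:
  assumes "chain_wfs n L R"
  shows "R = {g \<in> arrows n. \<forall>f\<in>L. lifts f g}"
proof (intro equalityI subsetI)
  fix g assume g: "g \<in> {g \<in> arrows n. \<forall>f\<in>L. lifts f g}"
  obtain i j where [simp]: "g = (i, j)" by (cases g)
  obtain k where "i \<le> k" "k \<le> j" "(i, k) \<in> L" "(k, j) \<in> R"
    using g chain_wfs_factor[OF assms, of i j] by (auto simp: arrows_def)
  then show "g \<in> R" using g by (force simp: lifts_def)
qed (use assms in \<open>auto simp: chain_wfs_def\<close>)

lemma chain_wfs_left_id:
  assumes "chain_wfs n L R" "i \<le> n"
  shows "(i, i) \<in> L"
  using chain_wfs_factor[OF assms(1), of i i] assms(2) by auto

lemma chain_wfs_left_comp:
  assumes "chain_wfs n L R" "(i, j) \<in> L" "(j, k) \<in> L"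
  shows "(i, k) \<in> L"
proof -
  have le: "i \<le> j" "j \<le> k" "k \<le> n"
    using assms by (auto simp: chain_wfs_def arrows_def)
  have "k \<le> a" if "(a, c) \<in> R" "i \<le> a" "k \<le> c" for a c
    using chain_wfs_lift[OF assms(1)] assms that le by (meson order_trans)
  then show ?thesis
    using le by (subst chain_wfs_left_eq[OF assms(1)]) (auto simp: arrows_def lifts_def)
qed

text \<open>Pushouts are joins: for i <= k <= j the arrow k -> j is the pushout of i -> j along i ->
  k.\<close>

lemma chain_wfs_left_pushout:
  assumes "chain_wfs n L R" "(i, j) \<in> L" "i \<le> k" "k \<le> j"
  shows "(k, j) \<in> L"
proof -
  have le: "j \<le> n"
    using assms by (auto simp: chain_wfs_def arrows_def)
  have "j \<le> a" if "(a, c) \<in> R" "k \<le> a" "j \<le> c" for a c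
    using chain_wfs_lift[OF assms(1)] assms that by (meson order_trans)
  then show ?thesis
    using le assms by (subst chain_wfs_left_eq[OF assms(1)]) (auto simp: arrows_def lifts_def)
qed

section \<open>Model structures on a chain\<close>

definition chain_two_out_of_three :: "nat \<Rightarrow> (nat \<times> nat) set \<Rightarrow> bool" where
  "chain_two_out_of_three n W \<longleftrightarrow> (\<forall>i j k. i \<le> j \<longrightarrow> j \<le> k \<longrightarrow> k \<le> n \<longrightarrow>
     ((i, j) \<in> W \<and> (j, k) \<in> W \<longrightarrow> (i, k) \<in> W) \<and>
     ((i, j) \<in> W \<and> (i, k) \<in> W \<longrightarrow> (j, k) \<in> W) \<and>
     ((j, k) \<in> W \<and> (i, k) \<in> W \<longrightarrow> (i, j) \<in> W))"

lemma two_out_of_three_ord_cat: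
  "two_out_of_three (ord_cat n) W \<longleftrightarrow> chain_two_out_of_three n W"
proof
  assume L: "two_out_of_three (ord_cat n) W"
  show "chain_two_out_of_three n W"
    unfolding chain_two_out_of_three_def
  proof (intro allI impI)
    fix i j k assume "i \<le> j" "j \<le> k" "k \<le> n"
    then have "(i, j) \<in> Ar (ord_cat n)" "(j, k) \<in> Ar (ord_cat n)"
      "Cod (ord_cat n) (i, j) = Dom (ord_cat n) (j, k)"
      by (auto simp: ord_cat_def)
    note H = bspec[OF bspec[OF L[unfolded two_out_of_three_def] this(1)] this(2), THEN mp, OF this(3)]
    have comp: "Comp (ord_cat n) (j, k) (i, j) = (i, k)" by (simp add: ord_cat_def)
    show "((i, j) \<in> W \<and> (j, k) \<in> W \<longrightarrow> (i, k) \<in> W) \<and>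
        ((i, j) \<in> W \<and> (i, k) \<in> W \<longrightarrow> (j, k) \<in> W) \<and>
        ((j, k) \<in> W \<and> (i, k) \<in> W \<longrightarrow> (i, j) \<in> W)"
      by (rule H[unfolded comp])
  qed
next
  assume R: "chain_two_out_of_three n W"
  show "two_out_of_three (ord_cat n) W"
    unfolding two_out_of_three_def
  proof (intro ballI impI)
    fix f g assume fg: "f \<in> Ar (ord_cat n)" "g \<in> Ar (ord_cat n)"
      "Cod (ord_cat n) f = Dom (ord_cat n) g"
    then obtain i j k where ijk: "f = (i, j)" "g = (j, k)" "i \<le> j" "j \<le> k" "k \<le> n"
      by (cases f; cases g) (auto simp: ord_cat_def)
    have comp: "Comp (ord_cat n) g f = (i, k)" by (simp add: ord_cat_def ijk)
    show "(f \<in> W \<and> g \<in> W \<longrightarrow> Comp (ord_cat n) g f \<in> W) \<and>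
        (f \<in> W \<and> Comp (ord_cat n) g f \<in> W \<longrightarrow> g \<in> W) \<and>
        (g \<in> W \<and> Comp (ord_cat n) g f \<in> W \<longrightarrow> f \<in> W)"
      unfolding comp unfolding ijk(1,2)
      using R[unfolded chain_two_out_of_three_def, THEN spec[of _ i], THEN spec[of _ j],
          THEN spec[of _ k], THEN mp, THEN mp, THEN mp, OF ijk(3-5)] .
  qed
qed

lemma chain_two_out_of_threeD:
  assumes "chain_two_out_of_three n W" "i \<le> j" "j \<le> k" "k \<le> n"
  shows chain_We_comp: "(i, j) \<in> W \<Longrightarrow> (j, k) \<in> W \<Longrightarrow> (i, k) \<in> W"
    and chain_We_cancel_left: "(i, j) \<in> W \<Longrightarrow> (i, k) \<in> W \<Longrightarrow> (j, k) \<in> W"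
    and chain_We_cancel_right: "(j, k) \<in> W \<Longrightarrow> (i, k) \<in> W \<Longrightarrow> (i, j) \<in> W"
  using assms unfolding chain_two_out_of_three_def by blast+

lemma model_structure_ord_cat:
  "model_structure (ord_cat n) W C F \<longleftrightarrow>
     W \<subseteq> arrows n \<and> chain_two_out_of_three n W \<and>
     chain_wfs n C (W \<inter> F) \<and> chain_wfs n (W \<inter> C) F"
  unfolding model_structure_def Ar_ord_cat two_out_of_three_ord_cat
    weak_factorization_system_ord_cat
  by (auto simp: category_ord_cat has_finite_limits_ord_cat has_finite_colimits_ord_cat
      chain_wfs_def)

text \<open>This is special to chains: 2-out-of-3 alone says nothing about the two halves of a weak
  equivalence. Comparing two factorizations ending at \<open>z\<close> supplies one of the
  halves.\<close>

lemma model_structure_ord_cat_We_interval: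
  assumes M: "model_structure (ord_cat n) W C F"
    and xz: "(x, z) \<in> W" "x \<le> y" "y \<le> z"
  shows "(x, y) \<in> W" "(y, z) \<in> W"
proof -
  have tot: "chain_two_out_of_three n W" and CF: "chain_wfs n C (W \<inter> F)" "chain_wfs n (W \<inter> C) F"
    and zn: "z \<le> n"
    using M xz by (auto simp: model_structure_ord_cat arrows_def)
  \<comment> \<open>Since c -> y is a weak equivalence, it suffices to show that x -> c is
    one.\<close>
  obtain c where c: "x \<le> c" "c \<le> y" "(x, c) \<in> C" "(c, y) \<in> W"
    using chain_wfs_factor[OF CF(1), of x y] xz zn by auto
  obtain d where d: "c \<le> d" "d \<le> z" "(c, d) \<in> W" "(c, d) \<in> C" "(d, z) \<in> F"
    using chain_wfs_factor[OF CF(2), of c z] xz zn c by auto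
  have xd: "(x, d) \<in> C" using chain_wfs_left_comp[OF CF(1) c(3) d(4)] .
  obtain e where e: "x \<le> e" "e \<le> z" "(x, e) \<in> W" "(x, e) \<in> C" "(e, z) \<in> F"
    using chain_wfs_factor[OF CF(2), of x z] xz zn by auto
  have "(e, z) \<in> W"
    using chain_We_cancel_left[OF tot, of x e z] e xz zn by simp
  \<comment> \<open>The cofibration x -> d lifts against the acyclic fibration e -> z, and the
    acyclic cofibration x -> e against the fibration d -> z. Hence x -> d is a weak equivalence, and
    c -> d cancels.\<close>
  then have "d \<le> e"
    using chain_wfs_lift[OF CF(1) xd, of e z] e d by auto
  moreover have "e \<le> d"
    using chain_wfs_lift[OF CF(2), of x e d z] e d c by auto
  ultimately have "d = e" by simp
  then have "(x, c) \<in> W"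
    using chain_We_cancel_right[OF tot, of x c d] e d c zn by simp
  then show "(x, y) \<in> W"
    using chain_We_comp[OF tot, of x c y] c xz zn by simp
  then show "(y, z) \<in> W"
    using chain_We_cancel_left[OF tot, of x y z] xz zn by simp
qed

section \<open>Encoding by pairs of functions\<close>

text \<open>Values beyond \<open>n\<close> are fixed to \<open>0\<close> so that distinct codes differ on \<open>{0..n}\<close>.\<close>

definition codes :: "nat \<Rightarrow> ((nat \<Rightarrow> nat) \<times> (nat \<Rightarrow> nat)) set" where
  "codes n = {(b, l).
     (\<forall>j\<le>n. b j \<le> l j \<and> l j \<le> j) \<and> (\<forall>j>n. b j = 0 \<and> l j = 0) \<and>
     (\<forall>j\<le>n. \<forall>i\<le>j. b j \<le> i \<longrightarrow> b i = b j) \<and>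
     (\<forall>j\<le>n. \<forall>i\<le>j. l j \<le> i \<longrightarrow> l j \<le> l i)}"

lemma codesD:
  assumes "(b, l) \<in> codes n"
  shows codes_le: "\<And>j. j \<le> n \<Longrightarrow> b j \<le> l j" "\<And>j. j \<le> n \<Longrightarrow> l j \<le> j"
    and codes_beyond: "\<And>j. j > n \<Longrightarrow> b j = 0" "\<And>j. j > n \<Longrightarrow> l j = 0"
    and codes_block: "\<And>i j. j \<le> n \<Longrightarrow> i \<le> j \<Longrightarrow> b j \<le> i \<Longrightarrow> b i = b j"
    and codes_nested: "\<And>i j. j \<le> n \<Longrightarrow> i \<le> j \<Longrightarrow> l j \<le> i \<Longrightarrow> l j \<le> l i"
  using assms unfolding codes_def mem_Collect_eq prod.case by blast+

definition above :: "nat \<Rightarrow> (nat \<Rightarrow> nat) \<Rightarrow> (nat \<times> nat) set" where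
  "above n f = {(i, j). i \<le> j \<and> j \<le> n \<and> f j \<le> i}"

definition least_source :: "nat \<Rightarrow> (nat \<times> nat) set \<Rightarrow> nat \<Rightarrow> nat" where
  "least_source n S j = (if j \<le> n then (LEAST i. (i, j) \<in> S) else 0)"

text \<open>Acyclic cofibrations force the fibrations as their right lifting class; the acyclic
  fibrations then force the cofibrations.\<close>

definition decode ::
  "nat \<Rightarrow> (nat \<Rightarrow> nat) \<times> (nat \<Rightarrow> nat) \<Rightarrow> (nat \<times> nat) set \<times> (nat \<times> nat) set \<times> (nat \<times> nat) set"
where
  "decode n = (\<lambda>(b, l).
     let W = above n b; F = {g \<in> arrows n. \<forall>f\<in>above n l. lifts f g}
     in (W, {f \<in> arrows n. \<forall>g\<in>W \<inter> F. lifts f g}, F))"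

definition encode ::
  "nat \<Rightarrow> (nat \<times> nat) set \<times> (nat \<times> nat) set \<times> (nat \<times> nat) set \<Rightarrow> (nat \<Rightarrow> nat) \<times> (nat \<Rightarrow> nat)"
where
  "encode n = (\<lambda>(W, C, F). (least_source n W, least_source n (W \<inter> C)))"

lemma least_source_above:
  assumes "\<And>j. j \<le> n \<Longrightarrow> f j \<le> j" "\<And>j. j > n \<Longrightarrow> f j = 0"
  shows "least_source n (above n f) = f"
proof
  fix j
  show "least_source n (above n f) j = f j"
    using assms by (auto simp: least_source_def above_def not_le intro!: Least_equality)
qed

text \<open>By \<open>up\<close>, the sources over a fixed target form an interval ending at that
  target, so the least one determines them. Weak equivalences satisfy this by closure under
  subintervals, acyclic cofibrations by pushout.\<close>

lemma above_least_source:
  assumes "S \<subseteq> arrows n" "\<And>j. j \<le> n \<Longrightarrow> (j, j) \<in> S"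
    and up: "\<And>i j k. (i, j) \<in> S \<Longrightarrow> i \<le> k \<Longrightarrow> k \<le> j \<Longrightarrow> (k, j) \<in> S"
  shows "above n (least_source n S) = S"
proof -
  have least: "(least_source n S j, j) \<in> S" if "j \<le> n" for j
    using LeastI[of "\<lambda>i. (i, j) \<in> S" j] that assms(2)[OF that] by (simp add: least_source_def)
  have le: "least_source n S j \<le> i" if "(i, j) \<in> S" for i j
    using that assms(1) Least_le[of "\<lambda>i. (i, j) \<in> S" i]
    by (auto simp: least_source_def arrows_def)
  show ?thesis
  proof (intro equalityI subrelI)
    fix i j
    show "(i, j) \<in> S" if "(i, j) \<in> above n (least_source n S)"
      using that up[OF least, of j i] by (auto simp: above_def)
    show "(i, j) \<in> above n (least_source n S)" if "(i, j) \<in> S"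
      using that le[OF that] assms(1) by (auto simp: above_def arrows_def)
  qed
qed

lemma decode_model_structure:
  assumes x: "(b, l) \<in> codes n" and dec: "decode n (b, l) = (W, C, F)"
  shows "model_structure (ord_cat n) W C F" and "W = above n b" and "W \<inter> C = above n l"
proof -
  define A where "A = above n l"
  note b = codes_le(1)[OF x] codes_block[OF x]
  note l = codes_le(2)[OF x] codes_nested[OF x]
  have W: "W = above n b" and F: "F = {g \<in> arrows n. \<forall>f\<in>A. lifts f g}"
    and C: "C = {f \<in> arrows n. \<forall>g\<in>W \<inter> F. lifts f g}"
    using dec by (auto simp: decode_def Let_def A_def)
  show "W = above n b" by (rule W)
  have Wiff: "(i, j) \<in> W \<longleftrightarrow> i \<le> j \<and> j \<le> n \<and> b j \<le> i" for i j
    by (simp add: W above_def)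
  have Aiff: "(i, j) \<in> A \<longleftrightarrow> i \<le> j \<and> j \<le> n \<and> l j \<le> i" for i j
    by (simp add: A_def above_def)
  have Fiff: "(k, m) \<in> F \<longleftrightarrow> k \<le> m \<and> m \<le> n \<and>
      (\<forall>i j. (i, j) \<in> A \<longrightarrow> i \<le> k \<longrightarrow> j \<le> m \<longrightarrow> j \<le> k)" for k m
    by (auto simp: F arrows_def lifts_def)
  have Ciff: "(i, j) \<in> C \<longleftrightarrow> i \<le> j \<and> j \<le> n \<and>
      (\<forall>k m. (k, m) \<in> W \<longrightarrow> (k, m) \<in> F \<longrightarrow> i \<le> k \<longrightarrow> j \<le> m \<longrightarrow> j \<le> k)" for i j
    by (auto simp: C arrows_def lifts_def Ball_def)
  have W_id: "(i, i) \<in> W" if "i \<le> n" for i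
    using that b(1)[of i] l(1)[of i] by (simp add: Wiff)
  have "(i, j) \<in> W" if "(i, j) \<in> A" for i j
    using that b(1)[of j] by (simp add: Aiff Wiff)
  then have A_W: "A \<subseteq> W" by (rule subrelI)
  \<comment> \<open>The nesting condition on \<open>l\<close> is exactly what composition needs: l k
    <= l j <= i.\<close>
  have A_comp: "(i, k) \<in> A" if "(i, j) \<in> A" "(j, k) \<in> A" for i j k
    using that l(2)[of k j] unfolding Aiff by linarith
  have A_push: "(k, j) \<in> A" if "(i, j) \<in> A" "i \<le> k" "k \<le> j" for i j k
    using that unfolding Aiff by linarith
  have W_interval: "(i, j) \<in> W" "(j, k) \<in> W" if "(i, k) \<in> W" "i \<le> j" "j \<le> k" for i j k
    using that b(2)[of k j] unfolding Wiff by auto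
  have W_comp: "(i, k) \<in> W" if "(i, j) \<in> W" "(j, k) \<in> W" for i j k
    using that b(2)[of k j] unfolding Wiff by auto
  have F_comp: "(i, k) \<in> F" if "(i, j) \<in> F" "(j, k) \<in> F" for i j k
    unfolding Fiff
  proof (intro conjI allI impI)
    fix x y assume "(x, y) \<in> A" "x \<le> i" "y \<le> k"
    moreover from this have "y \<le> j"
      using that unfolding Fiff by (meson order_trans)
    ultimately show "y \<le> i"
      using that unfolding Fiff by blast
  qed (use that in \<open>auto simp: Fiff\<close>)
  \<comment> \<open>Pullbacks are meets: i -> j is the pullback of i -> k along j -> k.\<close>
  have F_pull: "(i, j) \<in> F" if "(i, k) \<in> F" "i \<le> j" "j \<le> k" for i j k
    unfolding Fiff
  proof (intro conjI allI impI)
    fix x y assume "(x, y) \<in> A" "x \<le> i" "y \<le> j"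
    then show "y \<le> i"
      using that unfolding Fiff by (meson order_trans)
  qed (use that in \<open>auto simp: Fiff\<close>)
  have AF: "chain_wfs n A F"
    unfolding chain_wfs_def
  proof (intro conjI ballI, goal_cases)
    case (3 f)
    obtain i j where f: "f = (i, j)" "i \<le> j" "j \<le> n" using 3 by (auto simp: arrows_def)
    \<comment> \<open>Go as far as possible along \<open>A\<close>. An arrow a -> c of
      \<open>A\<close> with a <= k < c <= j would push out to k -> c and extend i -> k to i -> c,
      against maximality.\<close>
    let ?P = "\<lambda>k. (i, k) \<in> A \<and> k \<le> j"
    define k where "k = (GREATEST k. ?P k)"
    have "?P i" using f l(1)[of i] by (simp add: Aiff)
    then have k: "?P k" unfolding k_def by (rule GreatestI_nat) auto
    have max: "a \<le> k" if "?P a" for a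
      unfolding k_def using that by (rule Greatest_le_nat) auto
    have "(k, j) \<in> F"
      unfolding Fiff
    proof (intro conjI allI impI)
      fix a c assume a: "(a, c) \<in> A" "a \<le> k" "c \<le> j"
      show "c \<le> k"
      proof (rule ccontr)
        assume "\<not> c \<le> k"
        then have "(i, c) \<in> A"
          using A_comp[of i k c] A_push[of a c k] k a by auto
        then show False using max[of c] a \<open>\<not> c \<le> k\<close> by auto
      qed
    qed (use k f in auto)
    then show ?case using f k by auto
  qed (auto simp: F arrows_def Aiff)
  have CW: "chain_wfs n C (W \<inter> F)"
    unfolding chain_wfs_def
  proof (intro conjI ballI, goal_cases)
    case (3 f)
    obtain i j where f: "f = (i, j)" "i \<le> j" "j \<le> n" using 3 by (auto simp: arrows_def)
    \<comment> \<open>Dually, start the acyclic fibration into \<open>j\<close> as low as possible.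
      An acyclic fibration a -> c with i <= a < k <= c would pull back to a -> k and compose to a ->
      j, against minimality.\<close>
    let ?P = "\<lambda>k. i \<le> k \<and> (k, j) \<in> W \<inter> F"
    define k where "k = (LEAST k. ?P k)"
    have "(j, j) \<in> F" using f by (auto simp: Fiff)
    then have "?P j" using f W_id[of j] by auto
    then have k: "?P k" unfolding k_def by (rule LeastI)
    have min: "k \<le> a" if "?P a" for a
      unfolding k_def using that by (rule Least_le)
    have "(i, k) \<in> C"
      unfolding Ciff
    proof (intro conjI allI impI)
      fix a c assume a: "(a, c) \<in> W" "(a, c) \<in> F" "i \<le> a" "k \<le> c"
      show "k \<le> a"
      proof (rule ccontr)
        assume *: "\<not> k \<le> a"
        then have "(a, k) \<in> W" "(a, k) \<in> F"
          using W_interval[of a c k] F_pull[of a c k] a by auto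
        then have "(a, j) \<in> W \<inter> F"
          using W_comp[of a k j] F_comp[of a k j] k by auto
        then show False using min[of a] a * by auto
      qed
    qed (use k f in \<open>auto simp: Wiff\<close>)
    then show ?case using f k by auto
  qed (auto simp: C F)
  have "A \<subseteq> C"
    using AF by (auto simp: C chain_wfs_def)
  \<comment> \<open>Retract argument again: the right factor k -> j is a weak equivalence by the
    interval property, so i -> j lifts against it and j = k.\<close>
  moreover have "(i, j) \<in> A" if "(i, j) \<in> W" "(i, j) \<in> C" for i j
  proof -
    have "i \<le> j" "j \<le> n" using that by (auto simp: Wiff)
    then obtain k where k: "i \<le> k" "k \<le> j" "(i, k) \<in> A" "(k, j) \<in> F"
      using chain_wfs_factor[OF AF] by blast
    then have "(k, j) \<in> W" using W_interval that by blast
    then have "j \<le> k" using that(2) k by (auto simp: Ciff)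
    then show ?thesis using k by auto
  qed
  ultimately have WC: "W \<inter> C = A" using A_W by auto
  then show "W \<inter> C = above n l" by (simp add: A_def)
  have "chain_two_out_of_three n W"
    unfolding chain_two_out_of_three_def by (auto intro: W_comp W_interval)
  moreover have "W \<subseteq> arrows n" by (auto simp: Wiff arrows_def)
  ultimately show "model_structure (ord_cat n) W C F"
    using AF CW by (simp add: model_structure_ord_cat WC)
qed

text \<open>Each condition on a code reflects a closure property: constancy of \<open>b\<close> on a
  block comes from composition and subintervals of weak equivalences, nesting of \<open>l\<close>
  from composition of acyclic cofibrations.\<close>

lemma encode_codes:
  assumes M: "model_structure (ord_cat n) W C F"
  shows "encode n (W, C, F) \<in> codes n" and "decode n (encode n (W, C, F)) = (W, C, F)"
proof -
  define b where "b = least_source n W"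
  define l where "l = least_source n (W \<inter> C)"
  have enc: "encode n (W, C, F) = (b, l)"
    by (simp add: encode_def b_def l_def)
  have Wn: "W \<subseteq> arrows n" and tot: "chain_two_out_of_three n W"
    and CF: "chain_wfs n C (W \<inter> F)" "chain_wfs n (W \<inter> C) F"
    using M by (auto simp: model_structure_ord_cat)
  note WC_id = chain_wfs_left_id[OF CF(2)]
  have W: "above n b = W"
    unfolding b_def
  proof (rule above_least_source)
    show "(j, j) \<in> W" if "j \<le> n" for j using WC_id[OF that] by blast
  qed (use Wn model_structure_ord_cat_We_interval(2)[OF M] in blast)+
  have WC: "above n l = W \<inter> C"
    unfolding l_def
  proof (rule above_least_source)
    show "W \<inter> C \<subseteq> arrows n" using Wn by blast
  qed (use WC_id chain_wfs_left_pushout[OF CF(2)] in blast)+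
  have "F = {g \<in> arrows n. \<forall>f\<in>above n l. lifts f g}"
    using chain_wfs_right_eq[OF CF(2)] by (simp add: WC)
  then show "decode n (encode n (W, C, F)) = (W, C, F)"
    unfolding enc decode_def Let_def prod.case W
    using chain_wfs_left_eq[OF CF(1)] by simp
  have Wiff: "(i, j) \<in> W \<longleftrightarrow> i \<le> j \<and> j \<le> n \<and> b j \<le> i" for i j
    by (subst W[symmetric]) (simp add: above_def)
  have WCiff: "(i, j) \<in> W \<inter> C \<longleftrightarrow> i \<le> j \<and> j \<le> n \<and> l j \<le> i" for i j
    by (subst WC[symmetric]) (simp add: above_def)
  have lj: "l j \<le> j" if "j \<le> n" for j
    using WC_id[OF that] WCiff by blast
  have bl: "b j \<le> l j" if "j \<le> n" for j
    using WCiff[of "l j" j] Wiff[of "l j" j] lj[OF that] that by auto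
  have "b i = b j" if "j \<le> n" "i \<le> j" "b j \<le> i" for i j
  proof (rule antisym)
    have ij: "(i, j) \<in> W" using that by (simp add: Wiff)
    have "(b i, i) \<in> W"
      using that bl[of i] lj[of i] by (simp add: Wiff)
    then have "(b i, j) \<in> W"
      using chain_We_comp[OF tot, of "b i" i j] ij that by (simp add: Wiff)
    then show "b j \<le> b i" by (simp add: Wiff)
    have "(b j, j) \<in> W" using that by (simp add: Wiff)
    then have "(b j, i) \<in> W"
      using model_structure_ord_cat_We_interval(1)[OF M _ that(3) that(2)] by blast
    then show "b i \<le> b j" by (simp add: Wiff)
  qed
  moreover have "l j \<le> l i" if "j \<le> n" "i \<le> j" "l j \<le> i" for i j
  proof -
    have "(i, j) \<in> W \<inter> C" "(l i, i) \<in> W \<inter> C"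
      unfolding WCiff using that lj[of i] by auto
    then have "(l i, j) \<in> W \<inter> C" using chain_wfs_left_comp[OF CF(2)] by blast
    then show ?thesis unfolding WCiff by simp
  qed
  moreover have "b j = 0 \<and> l j = 0" if "j > n" for j
    using that by (simp add: b_def l_def least_source_def)
  ultimately show "encode n (W, C, F) \<in> codes n"
    unfolding enc codes_def mem_Collect_eq prod.case using lj bl by blast
qed

lemma card_model_structures_ord_cat: "card (model_structures (ord_cat n)) = card (codes n)"
proof (rule bij_betw_same_card[OF bij_betw_byWitness[where f' = "decode n" and f = "encode n"]])
  show "\<forall>M\<in>model_structures (ord_cat n). decode n (encode n M) = M"
    using encode_codes(2) by (auto simp: model_structures_def)
  show "\<forall>x\<in>codes n. encode n (decode n x) = x"
  proof
    fix x assume x: "x \<in> codes n"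
    obtain b l where bl: "x = (b, l)" by (cases x)
    obtain W C F where d: "decode n (b, l) = (W, C, F)" by (cases "decode n (b, l)")
    have "W = above n b" "W \<inter> C = above n l"
      using decode_model_structure[OF _ d] x bl by auto
    moreover have "least_source n (above n b) = b" "least_source n (above n l) = l"
      using x bl by (auto simp: codes_def intro!: least_source_above intro: order_trans)
    ultimately show "encode n (decode n x) = x"
      by (simp add: bl d encode_def)
  qed
  show "encode n ` model_structures (ord_cat n) \<subseteq> codes n"
    using encode_codes(1) by (auto simp: model_structures_def)
  show "decode n ` codes n \<subseteq> model_structures (ord_cat n)"
    using decode_model_structure(1) by (fastforce simp: model_structures_def)
qed

section \<open>Counting the codes\<close>

text \<open>These are the values at most \<open>n\<close> that \<open>l\<close> may take at a new
  top element joining the last block.\<close>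

definition starts :: "nat \<Rightarrow> (nat \<Rightarrow> nat) \<times> (nat \<Rightarrow> nat) \<Rightarrow> nat set" where
  "starts n = (\<lambda>(b, l). {a. b n \<le> a \<and> a \<le> n \<and> (\<forall>i. a \<le> i \<longrightarrow> i \<le> n \<longrightarrow> a \<le> l i)})"

text \<open>The pairs are the possible values of \<open>b\<close> and \<open>l\<close> at
  \<open>Suc n\<close>. The first opens a new block; the others join the last one, where
  \<open>l\<close> may also take the value \<open>Suc n\<close> itself.\<close>

definition extensions :: "nat \<Rightarrow> (nat \<Rightarrow> nat) \<times> (nat \<Rightarrow> nat) \<Rightarrow> (nat \<times> nat) set" where
  "extensions n x =
     insert (Suc n, Suc n) ((\<lambda>a. (fst x n, a)) ` insert (Suc n) (starts n x))"

definition extend ::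
  "nat \<Rightarrow> (nat \<Rightarrow> nat) \<times> (nat \<Rightarrow> nat) \<Rightarrow> nat \<times> nat \<Rightarrow> (nat \<Rightarrow> nat) \<times> (nat \<Rightarrow> nat)"
where
  "extend n x e = ((fst x)(Suc n := fst e), (snd x)(Suc n := snd e))"

lemma finite_starts: "finite (starts n x)"
  by (rule finite_subset[of _ "{..n}"]) (auto simp: starts_def)

text \<open>The ranks of the elements of a finite linear order run once through 1, ...,
  \<open>card S\<close>; adding a new maximum leaves the other ranks unchanged.\<close>

lemma sum_rank:
  fixes S :: "'a::linorder set" and f :: "nat \<Rightarrow> nat"
  assumes "finite S"
  shows "(\<Sum>a\<in>S. f (card {c \<in> S. c \<le> a})) = (\<Sum>t=1..card S. f t)"
  using assms
proof (induction S rule: finite_linorder_max_induct)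
  case (insert m S)
  have m: "m \<notin> S" using insert.hyps by auto
  have "{c \<in> insert m S. c \<le> a} = {c \<in> S. c \<le> a}" if "a \<in> S" for a
    using insert.hyps that by force
  moreover have "{c \<in> insert m S. c \<le> m} = insert m S"
    using insert.hyps by force
  ultimately show ?case
    using insert m by simp
qed simp

text \<open>In a new block only the top remains a start. When the top joins with value
  \<open>a\<close>, the one new closure condition is c <= a, so the surviving starts form an initial
  segment.\<close>

lemma card_starts_extend:
  assumes x: "x \<in> codes n"
  shows "card (starts (Suc n) (extend n x (Suc n, Suc n))) = 1"
    and "starts (Suc n) (extend n x (fst x n, a)) =
      {c \<in> insert (Suc n) (starts n x). c \<le> a}"
proof -
  have "starts (Suc n) (extend n x (Suc n, Suc n)) = {Suc n}"
    by (auto simp: starts_def extend_def)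
  then show "card (starts (Suc n) (extend n x (Suc n, Suc n))) = 1" by simp
next
  obtain b l where bl: "x = (b, l)" by (cases x)
  have "b n \<le> n"
    using x by (auto simp: bl codes_def intro: order_trans)
  show "starts (Suc n) (extend n x (fst x n, a)) = {c \<in> insert (Suc n) (starts n x). c \<le> a}"
  proof (rule set_eqI)
    fix c
    have upd: "(\<forall>i. c \<le> i \<longrightarrow> i \<le> Suc n \<longrightarrow> c \<le> (l(Suc n := a)) i) \<longleftrightarrow>
        c \<le> a \<and> (\<forall>i. c \<le> i \<longrightarrow> i \<le> n \<longrightarrow> c \<le> l i)" (is "?lhs \<longleftrightarrow> ?rhs") if "c \<le> Suc n"
    proof
      assume L: ?lhs
      have "c \<le> a" using L[rule_format, of "Suc n"] that by simp
      moreover have "c \<le> l i" if "c \<le> i" "i \<le> n" for i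
        using L[rule_format, of i] that by simp
      ultimately show ?rhs by blast
    next
      assume R: ?rhs
      show ?lhs
      proof (intro allI impI)
        fix i assume "c \<le> i" "i \<le> Suc n"
        then show "c \<le> (l(Suc n := a)) i" using R by (cases "i = Suc n") auto
      qed
    qed
    have "c \<in> starts (Suc n) (extend n x (fst x n, a)) \<longleftrightarrow> b n \<le> c \<and> c \<le> Suc n \<and>
        (\<forall>i. c \<le> i \<longrightarrow> i \<le> Suc n \<longrightarrow> c \<le> (l(Suc n := a)) i)"
      by (simp add: starts_def extend_def bl)
    then have "c \<in> starts (Suc n) (extend n x (fst x n, a)) \<longleftrightarrow>
        c \<le> Suc n \<and> b n \<le> c \<and> c \<le> a \<and> (\<forall>i. c \<le> i \<longrightarrow> i \<le> n \<longrightarrow> c \<le> l i)"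
      using upd by blast
    moreover have "c \<in> starts n x \<longleftrightarrow>
        b n \<le> c \<and> c \<le> n \<and> (\<forall>i. c \<le> i \<longrightarrow> i \<le> n \<longrightarrow> c \<le> l i)"
      by (simp add: starts_def bl)
    moreover have "b n \<le> Suc n" "c \<le> Suc n \<longleftrightarrow> c = Suc n \<or> c \<le> n" "\<not> Suc n \<le> n"
      using \<open>b n \<le> n\<close> by auto
    moreover have "\<not> i \<le> n" if "Suc n \<le> i" for i
      using that by simp
    ultimately show "c \<in> starts (Suc n) (extend n x (fst x n, a)) \<longleftrightarrow>
        c \<in> {c \<in> insert (Suc n) (starts n x). c \<le> a}"
      unfolding mem_Collect_eq insert_iff by blast
  qed
qed

lemma sum_extensions:
  assumes x: "x \<in> codes n"
  shows "(\<Sum>e\<in>extensions n x. f (card (starts (Suc n) (extend n x e)))) =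
    f 1 + (\<Sum>t=1..Suc (card (starts n x)). f t :: nat)"
proof -
  let ?S = "insert (Suc n) (starts n x)"
  have "fst x n \<le> n"
    using x by (auto simp: codes_def intro: order_trans)
  \<comment> \<open>Opening a block and joining one never coincide, because b n <= n.\<close>
  then have new: "(Suc n, Suc n) \<notin> (\<lambda>a. (fst x n, a)) ` ?S" by auto
  have "Suc n \<notin> starts n x" by (auto simp: starts_def)
  then have "card ?S = Suc (card (starts n x))" by (simp add: finite_starts)
  moreover have "(\<Sum>a\<in>?S. f (card (starts (Suc n) (extend n x (fst x n, a))))) =
      (\<Sum>a\<in>?S. f (card {c \<in> ?S. c \<le> a}))"
    by (intro sum.cong refl) (simp only: card_starts_extend(2)[OF x])
  moreover have "\<dots> = (\<Sum>t=1..card ?S. f t)"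
    by (rule sum_rank) (simp add: finite_starts)
  moreover have "inj_on (\<lambda>a. (fst x n, a)) ?S"
    by (simp add: inj_on_def)
  moreover have "finite ((\<lambda>a. (fst x n, a)) ` ?S)"
    by (simp add: finite_starts)
  ultimately show ?thesis
    unfolding extensions_def using card_starts_extend(1)[OF x] new
    by (simp only: sum.insert sum.reindex o_def not_False_eq_True)
qed

lemma bij_betw_extend:
  "bij_betw (\<lambda>(x, e). extend n x e) (SIGMA x:codes n. extensions n x) (codes (Suc n))"
\<comment> \<open>The inverse reads off the values at the top and resets them to the default 0, so
  that the truncation is again a code.\<close>
proof (rule bij_betw_byWitness[where f' =
    "\<lambda>(b, l). ((b(Suc n := 0), l(Suc n := 0)), (b (Suc n), l (Suc n)))"])
  show "\<forall>a\<in>SIGMA x:codes n. extensions n x.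
      (\<lambda>(b, l). ((b(Suc n := 0), l(Suc n := 0)), (b (Suc n), l (Suc n))))
        (case a of (x, e) \<Rightarrow> extend n x e) = a"
    by (auto simp: extend_def codes_def fun_eq_iff)
  show "\<forall>a\<in>codes (Suc n). (case case a of (b, l) \<Rightarrow>
      ((b(Suc n := 0), l(Suc n := 0)), (b (Suc n), l (Suc n))) of (x, e) \<Rightarrow> extend n x e) = a"
    by (auto simp: extend_def)
  show "(\<lambda>(x, e). extend n x e) ` (SIGMA x:codes n. extensions n x) \<subseteq> codes (Suc n)"
  proof (rule image_subsetI)
    fix p assume "p \<in> (SIGMA x:codes n. extensions n x)"
    then obtain b l w a where p: "p = ((b, l), (w, a))"
      and x: "(b, l) \<in> codes n" and e: "(w, a) \<in> extensions n (b, l)"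
      by (cases p) auto
    have "w = Suc n \<and> a = Suc n \<or> w = b n \<and> (a = Suc n \<or> a \<in> starts n (b, l))"
      using e by (auto simp: extensions_def)
    then have wa: "w \<le> a" "a \<le> Suc n" "\<And>i. a \<le> i \<Longrightarrow> i \<le> n \<Longrightarrow> a \<le> l i"
      and "w = Suc n \<or> w = b n"
      using codes_le[OF x, of n] by (auto simp: starts_def)
    then have w: "b i = w" if "w \<le> i" "i \<le> n" for i
      using codes_block[OF x order_refl, of i] that by auto
    show "(case p of (x, e) \<Rightarrow> extend n x e) \<in> codes (Suc n)"
      unfolding p codes_def extend_def mem_Collect_eq prod.case fst_conv snd_conv
    proof (intro conjI allI impI)
      fix j assume "j \<le> Suc n"
      then show "(b(Suc n := w)) j \<le> (l(Suc n := a)) j" "(l(Suc n := a)) j \<le> j"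
        using codes_le[OF x, of j] wa(1,2) by (auto simp: le_Suc_eq)
    next
      fix j assume "j > Suc n"
      then show "(b(Suc n := w)) j = 0" "(l(Suc n := a)) j = 0"
        using codes_beyond[OF x, of j] by auto
    next
      fix j i assume "j \<le> Suc n" "i \<le> j" "(b(Suc n := w)) j \<le> i"
      then show "(b(Suc n := w)) i = (b(Suc n := w)) j"
        using codes_block[OF x, of j i] w wa(1,2) by (cases "j = Suc n"; cases "i = Suc n") auto
    next
      fix j i assume "j \<le> Suc n" "i \<le> j" "(l(Suc n := a)) j \<le> i"
      then show "(l(Suc n := a)) j \<le> (l(Suc n := a)) i"
        using codes_nested[OF x, of j i] wa by (cases "j = Suc n"; cases "i = Suc n") auto
    qed
  qed
  show "(\<lambda>(b, l). ((b(Suc n := 0), l(Suc n := 0)), (b (Suc n), l (Suc n)))) ` codes (Suc n)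
      \<subseteq> (SIGMA x:codes n. extensions n x)"
  proof (rule image_subsetI)
    fix p assume "p \<in> codes (Suc n)"
    then obtain b l where p: "p = (b, l)" and x: "(b, l) \<in> codes (Suc n)"
      by (cases p) auto
    note top = codes_le[OF x order_refl] codes_block[OF x order_refl] codes_nested[OF x order_refl]
    have "(b(Suc n := 0), l(Suc n := 0)) \<in> codes n"
      unfolding codes_def mem_Collect_eq prod.case
    proof (intro conjI allI impI)
      fix j assume "j \<le> n"
      then show "(b(Suc n := 0)) j \<le> (l(Suc n := 0)) j" "(l(Suc n := 0)) j \<le> j"
        using codes_le[OF x, of j] by auto
    next
      fix j assume "j > n"
      then show "(b(Suc n := 0)) j = 0" "(l(Suc n := 0)) j = 0"
        using codes_beyond[OF x, of j] by auto
    next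
      fix j i assume "j \<le> n" "i \<le> j" "(b(Suc n := 0)) j \<le> i"
      then show "(b(Suc n := 0)) i = (b(Suc n := 0)) j"
        using codes_block[OF x, of j i] by auto
    next
      fix j i assume "j \<le> n" "i \<le> j" "(l(Suc n := 0)) j \<le> i"
      then show "(l(Suc n := 0)) j \<le> (l(Suc n := 0)) i"
        using codes_nested[OF x, of j i] by auto
    qed
    moreover have "(b (Suc n), l (Suc n)) \<in> extensions n (b(Suc n := 0), l(Suc n := 0))"
    proof (cases "b (Suc n) = Suc n")
      case True
      then show ?thesis using top(1,2) by (simp add: extensions_def)
    next
      case False
      \<comment> \<open>Now b (Suc n) <= n, so \<open>n\<close> lies in the block of the new
        top.\<close>
      then have "b n = b (Suc n)" using top(1,2) top(3)[of n] by simp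
      then show ?thesis
        using top(1,2) top(4) by (cases "l (Suc n) = Suc n") (auto simp: extensions_def starts_def image_iff)
    qed
    ultimately show "(case p of (b, l) \<Rightarrow> ((b(Suc n := 0), l(Suc n := 0)), (b (Suc n), l (Suc n))))
        \<in> (SIGMA x:codes n. extensions n x)"
      by (simp add: p)
  qed
qed

lemma codes_0: "codes 0 = {(\<lambda>_. 0, \<lambda>_. 0)}"
  by (auto simp: codes_def fun_eq_iff) (metis gr0I le_zero_eq)+

lemma finite_codes: "finite (codes n)"
proof (induction n)
  case (Suc n)
  have "finite (SIGMA x:codes n. extensions n x)"
    using Suc by (auto simp: extensions_def finite_starts)
  then show ?case using bij_betw_finite[OF bij_betw_extend[of n]] by simp
qed (simp add: codes_0)

lemma sum_codes_Suc:
  "(\<Sum>x\<in>codes (Suc n). f (card (starts (Suc n) x))) =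
    (\<Sum>x\<in>codes n. f 1 + (\<Sum>t=1..Suc (card (starts n x)). f t :: nat))"
proof -
  have "(\<Sum>x\<in>codes (Suc n). f (card (starts (Suc n) x))) =
      (\<Sum>(x, e)\<in>(SIGMA x:codes n. extensions n x). f (card (starts (Suc n) (extend n x e))))"
    by (subst sum.reindex_bij_betw[OF bij_betw_extend, symmetric]) (simp add: case_prod_unfold)
  also have "\<dots> = (\<Sum>x\<in>codes n. \<Sum>e\<in>extensions n x. f (card (starts (Suc n) (extend n x e))))"
    by (rule sum.Sigma[symmetric]) (auto simp: finite_codes extensions_def finite_starts)
  also have "\<dots> = (\<Sum>x\<in>codes n. f 1 + (\<Sum>t=1..Suc (card (starts n x)). f t))"
    by (intro sum.cong refl sum_extensions)
  finally show ?thesis .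
qed

text \<open>Hockey-stick summation by Pascal's rule. The extra term from opening a new block
  supplies the missing start of the telescoping.\<close>

lemma choose_recurrence:
  "(2 * k + 1 choose k) + (\<Sum>t=1..Suc s. 2 * k + t choose k) = 2 * Suc k + s choose Suc k"
proof (induction s)
  case 0
  \<comment> \<open>The symmetry k + (k + 1) = 2 k + 1 turns the extra term into the one that
    Pascal's rule needs.\<close>
  have "(2 * k + 1) choose k = (2 * k + 1) choose Suc k"
    by (subst binomial_symmetric) auto
  then show ?case by simp
qed simp

text \<open>Each summand counts the ways to adjoin \<open>k\<close> further elements to
  \<open>x\<close>, so the total depends only on n + k. The induction therefore trades a step in
  \<open>n\<close> for one in \<open>k\<close>, ending at the single code on one point, which has
  one start.\<close>

lemma sum_codes_choose:
  "(\<Sum>x\<in>codes n. 2 * k + card (starts n x) choose k) = 2 * (n + k) + 1 choose (n + k)"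
proof (induction n arbitrary: k)
  case 0
  show ?case by (simp add: codes_0 starts_def)
next
  case (Suc n)
  have "(\<Sum>x\<in>codes (Suc n). 2 * k + card (starts (Suc n) x) choose k) =
      (\<Sum>x\<in>codes n. 2 * Suc k + card (starts n x) choose Suc k)"
    by (simp only: sum_codes_Suc[of "\<lambda>s. 2 * k + s choose k"] choose_recurrence)
  also have "\<dots> = 2 * (Suc n + k) + 1 choose (Suc n + k)"
    by (simp only: Suc add_Suc_shift)
  finally show ?case .
qed

theorem theorem4p10:
  fixes n :: nat
  shows "card (model_structures (ord_cat n)) = (2 * n + 1) choose n"
  \<comment> \<open>At k = 0 every summand is 1, so the sum is the number of codes.\<close>
  using sum_codes_choose[where n = n and k = 0] by (simp add: card_model_structures_ord_cat)

end
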